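(* $\mathbf{P}$ is not a unique factorisation semiring: there is a profile admitting two factorisations into irreducible profiles (different from $(1)$) that are not rearrangements of one another.
   Context: A profile is a sequence $\mathbf{p}=(p_i)_{i\in\mathbb{N}}$ of natural numbers for which there exists $h\ge -1$ with $p_i\ge 1$ for $0\le i\le h$ and $p_i=0$ for $i>h$ (the null sequence $(0)$ is a profile); it is written as the finite sequence of its nonzero terms. $\mathbf{P}$ is the set of profiles, a commutative semiring with elementwise sum and product $(\mathbf{p}\times\mathbf{q})_i = p_i\sum_{j=0}^i q_j + q_i\sum_{j=0}^i p_j - p_i q_i$, with one $(1)=(1,0,0,\ldots)$. A profile $\mathbf{p}$ is irreducible if whenever $\mathbf{p}=\mathbf{q}\times\mathbf{r}$, one of $\mathbf{q},\mathbf{r}$ equals $(1)$. *)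

theory Defs
  imports "HOL-Library.Multiset"
begin

definition is_profile :: "(nat \<Rightarrow> nat) \<Rightarrow> bool" where
  "is_profile p \<longleftrightarrow>
     (\<exists>h::int. h \<ge> -1 \<and> (\<forall>i. int i \<le> h \<longrightarrow> p i \<ge> 1) \<and> (\<forall>i. int i > h \<longrightarrow> p i = 0))"

lemma is_profile_nat_iff:
  "is_profile p \<longleftrightarrow> (\<exists>n. (\<forall>i<n. p i \<ge> 1) \<and> (\<forall>i\<ge>n. p i = 0))"
proof
  assume "is_profile p"
  then obtain h :: int where h: "h \<ge> -1" "\<And>i. int i \<le> h \<Longrightarrow> p i \<ge> 1" "\<And>i. int i > h \<Longrightarrow> p i = 0"
    unfolding is_profile_def by blast
  have "p i \<ge> 1" if "i < nat (h + 1)" for i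
    using that h(1) by (intro h(2)) linarith
  moreover have "p i = 0" if "i \<ge> nat (h + 1)" for i
    using that h(1) by (intro h(3)) linarith
  ultimately show "\<exists>n. (\<forall>i<n. p i \<ge> 1) \<and> (\<forall>i\<ge>n. p i = 0)" by blast
next
  assume "\<exists>n. (\<forall>i<n. p i \<ge> 1) \<and> (\<forall>i\<ge>n. p i = 0)"
  then obtain n where n: "\<And>i. i < n \<Longrightarrow> p i \<ge> 1" "\<And>i. i \<ge> n \<Longrightarrow> p i = 0" by blast
  have "p i \<ge> 1" if "int i \<le> int n - 1" for i
    using that by (intro n(1)) linarith
  moreover have "p i = 0" if "int i > int n - 1" for i
    using that by (intro n(2)) linarith
  ultimately show "is_profile p"
    unfolding is_profile_def by (intro exI[of _ "int n - 1"]) auto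
qed

typedef profile = "{p. is_profile p}"
  morphisms pnth Abs_profile
proof
  show "(\<lambda>_. 0) \<in> {p. is_profile p}"
    by (auto simp: is_profile_nat_iff)
qed

setup_lifting type_definition_profile

text \<open>The subtraction below never truncates, because each partial sum contains its last term.\<close>

definition times_seq :: "(nat \<Rightarrow> nat) \<Rightarrow> (nat \<Rightarrow> nat) \<Rightarrow> nat \<Rightarrow> nat" where
  "times_seq p q i = p i * (\<Sum>j=0..i. q j) + q i * (\<Sum>j=0..i. p j) - p i * q i"

lemma times_seq_add: "times_seq p q i + p i * q i = p i * (\<Sum>j=0..i. q j) + q i * (\<Sum>j=0..i. p j)"
proof -
  have "q i \<le> (\<Sum>j=0..i. q j)" by (rule member_le_sum) auto
  then have "p i * q i \<le> p i * (\<Sum>j=0..i. q j)" by simp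
  then show ?thesis unfolding times_seq_def by linarith
qed

lemma sum_times_seq: "(\<Sum>j=0..i. times_seq p q j) = (\<Sum>j=0..i. p j) * (\<Sum>j=0..i. q j)"
proof (induction i)
  case 0
  then show ?case by (simp add: times_seq_def)
next
  case (Suc i)
  then show ?case using times_seq_add[of p q "Suc i"] by (simp add: algebra_simps)
qed

lemma seq_eqI:
  fixes p q :: "nat \<Rightarrow> nat"
  assumes "\<And>i. (\<Sum>j=0..i. p j) = (\<Sum>j=0..i. q j)"
  shows "p = q"
proof
  fix i
  show "p i = q i"
  proof (cases i)
    case 0
    then show ?thesis using assms[of 0] by simp
  next
    case (Suc k)
    then show ?thesis using assms[of k] assms[of "Suc k"] by simp
  qed
qed

lemma is_profile_plus:
  assumes "is_profile p" "is_profile q"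
  shows "is_profile (\<lambda>i. p i + q i)"
proof -
  obtain m where m: "\<forall>i<m. p i \<ge> 1" "\<forall>i\<ge>m. p i = 0"
    using assms(1) is_profile_nat_iff by blast
  obtain n where n: "\<forall>i<n. q i \<ge> 1" "\<forall>i\<ge>n. q i = 0"
    using assms(2) is_profile_nat_iff by blast
  have "p i + q i \<ge> 1" if "i < max m n" for i
    using that m(1) n(1) by (cases "i < m") (auto simp: trans_le_add1 trans_le_add2)
  moreover have "p i + q i = 0" if "i \<ge> max m n" for i
    using that m n by auto
  ultimately show ?thesis unfolding is_profile_nat_iff by blast
qed

lemma is_profile_times:
  assumes "is_profile p" "is_profile q"
  shows "is_profile (times_seq p q)"
proof -
  obtain m where m: "\<forall>i<m. p i \<ge> 1" "\<forall>i\<ge>m. p i = 0"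
    using assms(1) is_profile_nat_iff by blast
  obtain n where n: "\<forall>i<n. q i \<ge> 1" "\<forall>i\<ge>n. q i = 0"
    using assms(2) is_profile_nat_iff by blast
  show ?thesis
  proof (cases "m = 0 \<or> n = 0")
    case True
    then have "(\<forall>i. p i = 0) \<or> (\<forall>i. q i = 0)" using m n by auto
    then have "times_seq p q = (\<lambda>_. 0)" by (auto simp: times_seq_def)
    then show ?thesis by (auto simp: is_profile_nat_iff)
  next
    case False
    then have p0: "p 0 \<ge> 1" and q0: "q 0 \<ge> 1" using m n by auto
    have "times_seq p q i \<ge> 1" if i: "i < max m n" for i
    proof -
      have sp: "p 0 \<le> (\<Sum>j=0..i. p j)" "p i \<le> (\<Sum>j=0..i. p j)"
        by (rule member_le_sum; simp)+
      have sq: "q 0 \<le> (\<Sum>j=0..i. q j)" "q i \<le> (\<Sum>j=0..i. q j)"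
        by (rule member_le_sum; simp)+
      have *: "p i \<ge> 1 \<or> q i \<ge> 1" using i m n by (cases "i < m") auto
      have a: "p i * q i \<le> p i * (\<Sum>j=0..i. q j)" using sq by simp
      have b: "p i * q i \<le> q i * (\<Sum>j=0..i. p j)" using sp by simp
      have c: "p i * (\<Sum>j=0..i. q j) \<ge> 1" if "p i \<ge> 1"
        using that sq q0 by (simp add: Suc_le_eq)
      have d: "q i * (\<Sum>j=0..i. p j) \<ge> 1" if "q i \<ge> 1"
        using that sp p0 by (simp add: Suc_le_eq)
      show ?thesis
        using * a b c d times_seq_add[of p q i] by linarith
    qed
    moreover have "times_seq p q i = 0" if "i \<ge> max m n" for i
      using that m n by (simp add: times_seq_def)
    ultimately show ?thesis unfolding is_profile_nat_iff by blast
  qed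
qed

instantiation profile :: comm_semiring_1
begin

lift_definition zero_profile :: profile is "\<lambda>_. 0"
  by (auto simp: is_profile_nat_iff)

lift_definition one_profile :: profile is "\<lambda>i. if i = 0 then 1 else 0"
  by (auto simp: is_profile_nat_iff intro!: exI[of _ 1])

lift_definition plus_profile :: "profile \<Rightarrow> profile \<Rightarrow> profile" is "\<lambda>p q i. p i + q i"
  by (rule is_profile_plus)

lift_definition times_profile :: "profile \<Rightarrow> profile \<Rightarrow> profile" is times_seq
  by (rule is_profile_times)

instance
proof
  fix a b c :: profile
  have one: "(\<Sum>j=0..i. if j = 0 then 1 else 0 :: nat) = 1" for i :: nat
    by (simp add: sum.delta)
  show "a + b + c = a + (b + c)" by transfer (simp add: add.assoc)
  show "a + b = b + a" by transfer (simp add: add.commute)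
  show "0 + a = a" by transfer simp
  show "a * b * c = a * (b * c)"
    by transfer (rule seq_eqI, simp add: sum_times_seq mult.assoc)
  show "a * b = b * a"
    by transfer (rule seq_eqI, simp add: sum_times_seq mult.commute)
  show "1 * a = a"
    by transfer (rule seq_eqI, simp only: sum_times_seq one mult_1)
  show "(a + b) * c = a * c + b * c"
    by transfer (rule seq_eqI, simp add: sum_times_seq sum.distrib distrib_right)
  show "0 * a = 0" by transfer (simp add: times_seq_def fun_eq_iff)
  show "a * 0 = 0" by transfer (simp add: times_seq_def fun_eq_iff)
  show "(0::profile) \<noteq> 1" by transfer (auto simp: fun_eq_iff)
qed

end

text \<open>By this definition \<open>1\<close> itself is irreducible, so it has to be excluded separately.\<close>

definition irreducible_profile :: "profile \<Rightarrow> bool" where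
  "irreducible_profile p \<longleftrightarrow> (\<forall>q r. p = q * r \<longrightarrow> q = 1 \<or> r = 1)"

end

theory Submission
  imports Defs "HOL-Computational_Algebra.Primes"
begin

text \<open>
  Passing to partial sums turns the product of profiles into the pointwise product. A profile
  whose total is prime is therefore irreducible, since one of two factors has total 1 and
  hence equals \<open>(1)\<close>. In terms of partial sums, \<open>(2, 3) \<cdot> (1, 5) = (2, 15) = (2, 5) \<cdot> (1, 3)\<close>,
  and all four factors have prime total.
\<close>

definition psum :: "profile \<Rightarrow> nat \<Rightarrow> nat" where
  "psum p i = (\<Sum>j=0..i. pnth p j)"

lemma psum_times: "psum (p * q) i = psum p i * psum q i"
  by (simp add: psum_def times_profile.rep_eq sum_times_seq)

lemma psum_one: "psum 1 i = 1"
  by (simp add: psum_def one_profile.rep_eq sum.delta)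

lemma psum_mono: "i \<le> j \<Longrightarrow> psum p i \<le> psum p j"
  unfolding psum_def by (rule sum_mono2) auto

lemma psum_inject: "psum p = psum q \<longleftrightarrow> p = q"
proof
  assume "psum p = psum q"
  then have "pnth p = pnth q"
    by (intro seq_eqI) (simp add: psum_def fun_eq_iff)
  then show "p = q"
    by (simp add: pnth_inject)
qed simp

text \<open>The nonzero terms of a profile form an initial segment, so a vanishing first term makes
  all terms vanish.\<close>

lemma psum_eq_0_iff: "psum p i = 0 \<longleftrightarrow> p = 0"
proof
  assume "psum p i = 0"
  then have "pnth p 0 = 0"
    by (simp add: psum_def)
  moreover have "is_profile (pnth p)"
    using pnth by blast
  ultimately have "pnth p j = 0" for j
    unfolding is_profile_nat_iff by (metis gr0I le0 not_one_le_zero)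
  then show "p = 0"
    by (simp add: pnth_inject [symmetric] zero_profile.rep_eq fun_eq_iff)
qed (simp add: psum_def zero_profile.rep_eq)

text \<open>Before \<open>n\<close> the partial sums are at most 1 by monotonicity and nonzero
  because \<open>p\<close> is not null.\<close>

lemma eq_1_if_total_1:
  assumes "\<And>i. i \<ge> n \<Longrightarrow> psum p i = 1"
  shows "p = 1"
proof -
  have "psum p i = 1" for i
  proof (cases "i \<ge> n")
    case False
    then have "psum p i \<le> 1"
      using psum_mono[of i n p] assms[of n] by simp
    moreover have "psum p i \<noteq> 0"
      using assms[of n] psum_eq_0_iff by (metis order_refl zero_neq_one)
    ultimately show ?thesis by linarith
  qed (simp add: assms)
  then show ?thesis
    by (simp add: psum_inject [symmetric] psum_one fun_eq_iff)
qed

lemma irreducible_profile_if_prime_total: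
  assumes t: "prime t" and total: "\<And>i. i \<ge> n \<Longrightarrow> psum p i = t"
  shows "irreducible_profile p"
proof -
  \<comment> \<open>The value \<open>t\<close> at \<open>n\<close> persists: for
    \<open>i \<ge> n\<close>, \<open>psum r i\<close> is at least \<open>t\<close> by monotonicity
    and divides \<open>t\<close>. This leaves 1 for \<open>psum q i\<close>.\<close>
  have eq_1: "q = 1" if p: "p = q * r" and r: "psum r n = t" for q r
  proof (rule eq_1_if_total_1)
    fix i assume "i \<ge> n"
    then have qr: "psum q i * psum r i = t"
      using total p psum_times by metis
    have "t \<le> psum r i"
      using psum_mono[OF \<open>i \<ge> n\<close>, of r] r by simp
    moreover have "psum r i dvd t"
      using qr by (metis dvd_triv_right)
    ultimately have "psum r i = t"
      using t prime_gt_0_nat by (metis dvd_imp_le le_antisym)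
    then show "psum q i = 1"
      using qr t prime_gt_0_nat by fastforce
  qed
  show ?thesis
    unfolding irreducible_profile_def
  proof (intro allI impI)
    fix q r assume p: "p = q * r"
    then have "psum q n * psum r n = t"
      using total psum_times by (metis order_refl)
    then have "psum q n = t \<or> psum r n = t"
      using t by (metis prime_product mult.right_neutral mult_1)
    then show "q = 1 \<or> r = 1"
      using eq_1 p by (metis mult.commute)
  qed
qed

text \<open>For \<open>a = 0 < b\<close> the sequence is not a profile and
  \<open>Abs_profile\<close> is unspecified there.\<close>

definition profile2 :: "nat \<Rightarrow> nat \<Rightarrow> profile" where
  "profile2 a b = Abs_profile (\<lambda>i. if i = 0 then a else if i = 1 then b else 0)"

lemma psum_profile2:
  assumes "a > 0" "b > 0"
  shows "psum (profile2 a b) i = (if i = 0 then a else a + b)"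
proof -
  have "is_profile (\<lambda>i. if i = 0 then a else if i = 1 then b else 0)"
    unfolding is_profile_nat_iff using assms by (intro exI[of _ 2]) auto
  then have nth: "pnth (profile2 a b) = (\<lambda>i. if i = 0 then a else if i = 1 then b else 0)"
    by (simp add: profile2_def Abs_profile_inverse)
  show ?thesis
    by (induction i) (auto simp: psum_def nth)
qed

lemma irreducible_profile2:
  assumes "a > 0" "b > 0" "prime (a + b)"
  shows "irreducible_profile (profile2 a b)" "profile2 a b \<noteq> 1"
proof -
  show "irreducible_profile (profile2 a b)"
    using assms by (intro irreducible_profile_if_prime_total[of "a + b" 1]) (auto simp: psum_profile2)
  \<comment> \<open>The partial sums at index 1 differ: \<open>a + b\<close> is prime, so it is not
    1.\<close>
  show "profile2 a b \<noteq> 1"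
    using assms psum_profile2[of a b 1] psum_one[of 1] by auto
qed

theorem theorem4:
  "\<exists>(p::profile) (A::profile multiset) (B::profile multiset).
     (\<forall>q\<in>#A. irreducible_profile q \<and> q \<noteq> 1) \<and>
     (\<forall>q\<in>#B. irreducible_profile q \<and> q \<noteq> 1) \<and>
     p = prod_mset A \<and> p = prod_mset B \<and> A \<noteq> B"
proof -
  \<comment> \<open>The arguments of \<open>profile2\<close> are the differences of the chosen
    partial sums (2, 3), (1, 5) and (2, 5), (1, 3). Swapping 3 and 5 preserves the product.\<close>
  let ?A = "{#profile2 2 1, profile2 1 4#}" and ?B = "{#profile2 2 3, profile2 1 2#}"
  have primes: "prime (3::nat)" "prime (5::nat)"
    by simp_all
  have "\<forall>q\<in>#?A. irreducible_profile q \<and> q \<noteq> 1" "\<forall>q\<in>#?B. irreducible_profile q \<and> q \<noteq> 1"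
    using irreducible_profile2[of 2 1] irreducible_profile2[of 1 4]
      irreducible_profile2[of 2 3] irreducible_profile2[of 1 2] primes
    by (auto simp: numeral_3_eq_3 [symmetric])
  moreover have "prod_mset ?A = prod_mset ?B"
    by (simp add: psum_inject [symmetric] fun_eq_iff psum_times psum_profile2)
  moreover have "?A \<noteq> ?B"
  proof
    assume "?A = ?B"
    then have "profile2 2 1 \<in># ?B"
      by (metis union_single_eq_member)
    then have "profile2 2 1 = profile2 2 3 \<or> profile2 2 1 = profile2 1 2"
      by simp
    \<comment> \<open>The first equation fails at index 1 (3 against 5), the second at index 0 (2
      against 1).\<close>
    then have "psum (profile2 2 1) = psum (profile2 2 3) \<or> psum (profile2 2 1) = psum (profile2 1 2)"
      by auto
    then show False
      by (auto simp: psum_profile2 fun_eq_iff split: if_splits)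
  qed
  ultimately show ?thesis by blast
qed

end
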